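(* Let $X\subseteq \mathbb{C}^n$ be an irreducible affine cone which is not a linear subspace. Then \[ X^{*}\subseteq \mathrm{DS}(X)\subseteq X^{*}+\mathrm{Sing}\,X, \] where $X^{*}+\mathrm{Sing}\,X=\{a+b : a\in X^{*},\ b\in \mathrm{Sing}\,X\}$.
   Context: Work over $\mathbb{C}^n$ with the standard symmetric bilinear form $(x|y)=\sum_{i=1}^n x_iy_i$. Let $X\subseteq\mathbb{C}^n$ be an irreducible variety of codimension $c$ with radical defining ideal $I$; $\mathrm{Jac}_x(I)$ is the Jacobian matrix of a generating set of $I$ at $x$. $\mathrm{Sing}\,X$ is the set of $x\in X$ at which all $c\times c$ minors of $\mathrm{Jac}_x(I)$ vanish, and $X^{\mathrm{reg}}=X\setminus \mathrm{Sing}\,X$. The ED correspondence $\mathcal{E}_X\subseteq \mathbb{C}^n_u\times\mathbb{C}^n_x$ is the Zariski closure of the set of pairs $(u,x)$ with $u\in\mathbb{C}^n$, $x\in X^{\mathrm{reg}}$ and $\mathrm{rank}\begin{pmatrix}u-x\\ \mathrm{Jac}_x(I)\end{pmatrix}\le c$ (i.e. $u-x$ is orthogonal, w.r.t. $(\cdot|\cdot)$, to the tangent space $T_xX$; equivalently $x$ is a critical point of $d_u(x)=\sum_i(u_i-x_i)^2$ on $X^{\mathrm{reg}}$). Let $\pi_1,\pi_2$ be the projections of $\mathcal{E}_X$ to the $u$- and $x$-coordinates. The ED data singular locus is $\mathrm{DS}(X)=\pi_1(\mathcal{E}_X\cap\pi_2^{-1}(\mathrm{Sing}\,X))$. The dual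 variety $X^{*}\subseteq\mathbb{C}^n$ is the Zariski closure of the set of $u\in\mathbb{C}^n$ such that $(u|v)=0$ for all $v\in T_xX$ for some $x\in X^{\mathrm{reg}}$ (dual identified with $\mathbb{C}^n$ via $(\cdot|\cdot)$). An affine cone is a variety stable under scaling, i.e. defined by homogeneous polynomials. *)

theory Defs
  imports "HOL-Analysis.Analysis"
begin

text \<open>Polynomial functions on a point set of type 'a, generated by constants and
  the coordinate functions coord i (i of type 'i) under sums and products.
  Over the infinite field C, polynomial functions correspond bijectively to polynomials.\<close>
inductive polyfun :: "('i \<Rightarrow> 'a \<Rightarrow> complex) \<Rightarrow> ('a \<Rightarrow> complex) \<Rightarrow> bool"
  for coord :: "'i \<Rightarrow> 'a \<Rightarrow> complex" where
  pf_const: "polyfun coord (\<lambda>_. c)"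
| pf_coord: "polyfun coord (coord i)"
| pf_add: "polyfun coord f \<Longrightarrow> polyfun coord g \<Longrightarrow> polyfun coord (\<lambda>p. f p + g p)"
| pf_mult: "polyfun coord f \<Longrightarrow> polyfun coord g \<Longrightarrow> polyfun coord (\<lambda>p. f p * g p)"

definition zariski_closure :: "('i \<Rightarrow> 'a \<Rightarrow> complex) \<Rightarrow> 'a set \<Rightarrow> 'a set" where
  "zariski_closure coord S =
     {p. \<forall>f. polyfun coord f \<and> (\<forall>q\<in>S. f q = 0) \<longrightarrow> f p = 0}"

definition cn_coord :: "'n \<Rightarrow> complex^'n \<Rightarrow> complex" where
  "cn_coord i x = x $ i"

definition pair_coord :: "('n + 'n) \<Rightarrow> ((complex^'n) \<times> (complex^'n)) \<Rightarrow> complex" where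
  "pair_coord k p = (case k of Inl i \<Rightarrow> fst p $ i | Inr i \<Rightarrow> snd p $ i)"

definition zariski_closed :: "(complex^'n) set \<Rightarrow> bool" where
  "zariski_closed X \<longleftrightarrow>
     (\<exists>F. (\<forall>f\<in>F. polyfun cn_coord f) \<and> X = {x. \<forall>f\<in>F. f x = 0})"

definition irreducible_variety :: "(complex^'n) set \<Rightarrow> bool" where
  "irreducible_variety X \<longleftrightarrow> zariski_closed X \<and> X \<noteq> {} \<and>
     (\<forall>A B. zariski_closed A \<and> zariski_closed B \<and> X = A \<union> B \<longrightarrow> X = A \<or> X = B)"

definition var_dim :: "(complex^'n) set \<Rightarrow> nat" where
  "var_dim X = Sup {k. \<exists>Y :: nat \<Rightarrow> (complex^'n) set.
       (\<forall>i\<le>k. irreducible_variety (Y i) \<and> Y i \<subseteq> X) \<and> (\<forall>i<k. Y i \<subset> Y (Suc i))}"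

definition codim :: "(complex^'n) set \<Rightarrow> nat" where
  "codim X = CARD('n) - var_dim X"

definition var_ideal :: "(complex^'n) set \<Rightarrow> (complex^'n \<Rightarrow> complex) set" where
  "var_ideal X = {f. polyfun cn_coord f \<and> (\<forall>x\<in>X. f x = 0)}"

definition pderiv_at :: "(complex^'n \<Rightarrow> complex) \<Rightarrow> complex^'n \<Rightarrow> 'n \<Rightarrow> complex" where
  "pderiv_at f x i = deriv (\<lambda>t. f (x + t *s axis i 1)) 0"

definition grad_at :: "(complex^'n \<Rightarrow> complex) \<Rightarrow> complex^'n \<Rightarrow> complex^'n" where
  "grad_at f x = (\<chi> i. pderiv_at f x i)"

text \<open>Rows of the Jacobian of (all elements of) the ideal at x; their span equals the row
  space of the Jacobian of any generating set at points of X.\<close>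
definition jac_rows :: "(complex^'n) set \<Rightarrow> complex^'n \<Rightarrow> (complex^'n) set" where
  "jac_rows X x = {grad_at f x | f. f \<in> var_ideal X}"

text \<open>Sing X: points where all c x c minors of the Jacobian vanish, i.e. its rank is < c.\<close>
definition Sing :: "(complex^'n) set \<Rightarrow> (complex^'n) set" where
  "Sing X = {x \<in> X. vec.dim (jac_rows X x) < codim X}"

definition Xreg :: "(complex^'n) set \<Rightarrow> (complex^'n) set" where
  "Xreg X = X - Sing X"

definition bilin :: "complex^'n \<Rightarrow> complex^'n \<Rightarrow> complex" where
  "bilin x y = (\<Sum>i\<in>UNIV. x $ i * y $ i)"

definition tangent_space :: "(complex^'n) set \<Rightarrow> complex^'n \<Rightarrow> (complex^'n) set" where
  "tangent_space X x = {v. \<forall>g\<in>jac_rows X x. bilin g v = 0}"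

definition ED_corr :: "(complex^'n) set \<Rightarrow> ((complex^'n) \<times> (complex^'n)) set" where
  "ED_corr X = zariski_closure pair_coord
     {(u, x). x \<in> Xreg X \<and> vec.dim (insert (u - x) (jac_rows X x)) \<le> codim X}"

definition ED_data_singular :: "(complex^'n) set \<Rightarrow> (complex^'n) set" where
  "ED_data_singular X = fst ` (ED_corr X \<inter> {p. snd p \<in> Sing X})"

definition dual_variety :: "(complex^'n) set \<Rightarrow> (complex^'n) set" where
  "dual_variety X = zariski_closure cn_coord
     {u. \<exists>x\<in>Xreg X. \<forall>v\<in>tangent_space X x. bilin u v = 0}"

definition affine_cone :: "(complex^'n) set \<Rightarrow> bool" where
  "affine_cone X \<longleftrightarrow> (\<forall>t::complex. \<forall>x\<in>X. t *s x \<in> X)"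

end

theory Submission
  imports Defs "HOL-Library.Function_Algebras" "HOL-Computational_Algebra.Polynomial"
begin

text \<open>
  For regular \<open>x\<close>, the rank condition on \<open>(u, x)\<close> says that \<open>u - x\<close> is conormal at \<open>x\<close>.
  Hence the map \<open>(u, x) \<mapsto> u - x\<close> sends the correspondence to \<open>X\<^sup>*\<close>, and \<open>u = (u - x) + x\<close> gives
  the second inclusion. If \<open>u\<close> is conormal at \<open>x\<close>, then on a cone it is also conormal at \<open>t x\<close> for
  \<open>t \<noteq> 0\<close>, so \<open>(u + t x, t x)\<close> lies in the correspondence, and \<open>t \<rightarrow> 0\<close> yields \<open>(u, 0)\<close>. It remains
  to see that \<open>0\<close> is singular: \<open>X\<close> is strictly contained in the linear space \<open>T\<^sub>0X\<close>, hence
  has smaller dimension.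

  What is needed from dimension theory is that the length of a chain of irreducible subvarieties
  of \<open>X\<close> plus the rank of the Jacobian at any point is at most \<open>n\<close>. Along a chain one finds
  growing sets \<open>J\<close> of coordinates that are algebraically independent on its members, and if \<open>J\<close>
  is algebraically independent on \<open>X\<close>, then one relation for each coordinate outside \<open>J\<close> suffices to
  span the row space of the Jacobian at a general point.
\<close>

section \<open>Closure properties of polynomial functions\<close>

lemma polyfun_sum:
  "finite A \<Longrightarrow> (\<And>a. a \<in> A \<Longrightarrow> polyfun coord (f a)) \<Longrightarrow> polyfun coord (\<lambda>p. \<Sum>a\<in>A. f a p)"
  by (induction A rule: finite_induct) (auto intro: polyfun.intros)

lemma polyfun_prod:
  "finite A \<Longrightarrow> (\<And>a. a \<in> A \<Longrightarrow> polyfun coord (f a)) \<Longrightarrow> polyfun coord (\<lambda>p. \<Prod>a\<in>A. f a p)"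
  by (induction A rule: finite_induct) (auto intro: polyfun.intros)

text \<open>This pulls equations back along polynomial maps such as scaling and
  \<open>(u, x) \<mapsto> u - x\<close>.\<close>

lemma polyfun_compose:
  assumes "polyfun coord f" and "\<And>i. polyfun coord' (\<lambda>q. coord i (\<phi> q))"
  shows "polyfun coord' (\<lambda>q. f (\<phi> q))"
  using assms(1) by induction (auto intro: polyfun.intros assms(2))

lemma polyfun_diff:
  assumes "polyfun coord f" "polyfun coord g"
  shows "polyfun coord (\<lambda>p. f p - g p)"
  using pf_add[OF assms(1) pf_mult[OF pf_const[of _ "-1"] assms(2)]] by simp

section \<open>Polynomials in some of the coordinates, and splitting off one variable\<close>

text \<open>Coordinates outside \<open>S\<close> become the zero function, so
  \<open>polyfun (subcoord S)\<close> describes polynomials in the coordinates of \<open>S\<close>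
  while the index type stays \<open>'n\<close>.\<close>

definition subcoord :: "'n set \<Rightarrow> 'n \<Rightarrow> complex^'n \<Rightarrow> complex" where
  "subcoord S i x = (if i \<in> S then x $ i else 0)"

lemma subcoord_UNIV: "subcoord UNIV = cn_coord"
  by (simp add: fun_eq_iff subcoord_def cn_coord_def)

lemma polyfun_subcoord_mono:
  assumes "polyfun (subcoord S) f" "S \<subseteq> T"
  shows "polyfun (subcoord T) f"
  using assms(1)
proof induction
  case (pf_coord i)
  show ?case
  proof (cases "i \<in> S")
    case True
    then have "subcoord S i = subcoord T i"
      using assms(2) by (auto simp: subcoord_def fun_eq_iff)
    then show ?thesis by (metis polyfun.pf_coord)
  next
    case False
    then have "subcoord S i = (\<lambda>_. 0)" by (auto simp: subcoord_def fun_eq_iff)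
    then show ?thesis by (metis polyfun.pf_const)
  qed
qed (auto intro: polyfun.intros)

lemma polyfun_subcoord_cn: "polyfun (subcoord S) f \<Longrightarrow> polyfun cn_coord f"
  using polyfun_subcoord_mono[of S f UNIV] by (simp add: subcoord_UNIV)

lemma polyfun_subcoord_empty: "polyfun (subcoord {}) f \<Longrightarrow> \<exists>c. f = (\<lambda>_. c)"
  by (induction rule: polyfun.induct) (auto simp: subcoord_def fun_eq_iff)

lemma polyfun_plus: "polyfun coord f \<Longrightarrow> polyfun coord g \<Longrightarrow> polyfun coord (f + g)"
  and polyfun_minus: "polyfun coord f \<Longrightarrow> polyfun coord g \<Longrightarrow> polyfun coord (f - g)"
  and polyfun_times: "polyfun coord f \<Longrightarrow> polyfun coord g \<Longrightarrow> polyfun coord (f * g)"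
  by (simp_all add: plus_fun_def fun_diff_def times_fun_def pf_add pf_mult polyfun_diff)

lemma polyfun_zero: "polyfun coord 0" and polyfun_one: "polyfun coord 1"
  by (simp_all add: zero_fun_def one_fun_def pf_const)

lemma power_fun_apply: "(f ^ n) x = (f x :: 'b :: comm_ring_1) ^ n"
  by (induction n) (auto)

lemma polyfun_power: "polyfun coord f \<Longrightarrow> polyfun coord (f ^ n)"
  by (induction n) (auto intro: polyfun_one polyfun_times)

lemma polyfun_sum_fun:
  "finite A \<Longrightarrow> (\<And>a. a \<in> A \<Longrightarrow> polyfun coord (f a)) \<Longrightarrow> polyfun coord (sum f A)"
  by (induction A rule: finite_induct) (auto intro: polyfun_zero polyfun_plus)

text \<open>Coefficients live in the ring of all functions with pointwise operations, which has zero
  divisors; the predicate confines them to polynomials in the coordinates of \<open>S\<close>.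
  Evaluation at \<open>coordfun j\<close> adjoins the coordinate \<open>j\<close>.\<close>

definition poly_over :: "'n set \<Rightarrow> (complex^'n \<Rightarrow> complex) poly \<Rightarrow> bool" where
  "poly_over S p \<longleftrightarrow> (\<forall>i. polyfun (subcoord S) (coeff p i))"

definition coordfun :: "'n \<Rightarrow> complex^'n \<Rightarrow> complex" where
  "coordfun j x = x $ j"

lemma polyfun_coordfun: "j \<in> S \<Longrightarrow> polyfun (subcoord S) (coordfun j)"
proof -
  assume "j \<in> S"
  then have "coordfun j = subcoord S j" by (auto simp: coordfun_def subcoord_def)
  then show ?thesis by (metis pf_coord)
qed

lemma poly_over_0: "poly_over S 0"
  by (simp add: poly_over_def polyfun_zero)

lemma poly_over_const: "polyfun (subcoord S) c \<Longrightarrow> poly_over S [:c:]"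
  by (auto simp: poly_over_def coeff_pCons polyfun_zero split: nat.splits)

lemma poly_over_monom: "polyfun (subcoord S) c \<Longrightarrow> poly_over S (monom c n)"
  by (auto simp: poly_over_def polyfun_zero)

lemma poly_over_add: "poly_over S p \<Longrightarrow> poly_over S q \<Longrightarrow> poly_over S (p + q)"
  by (auto simp: poly_over_def intro: polyfun_plus)

lemma poly_over_diff: "poly_over S p \<Longrightarrow> poly_over S q \<Longrightarrow> poly_over S (p - q)"
  by (auto simp: poly_over_def intro: polyfun_minus)

lemma poly_over_mult: "poly_over S p \<Longrightarrow> poly_over S q \<Longrightarrow> poly_over S (p * q)"
  by (auto simp: poly_over_def coeff_mult intro: polyfun_times polyfun_sum_fun)

lemma poly_over_smult: "polyfun (subcoord S) c \<Longrightarrow> poly_over S q \<Longrightarrow> poly_over S (smult c q)"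
  by (auto simp: poly_over_def intro: polyfun_times)

lemmas poly_over_intros = poly_over_0 poly_over_const poly_over_monom poly_over_add
  poly_over_diff poly_over_mult poly_over_smult

lemma poly_over_mono: "poly_over S p \<Longrightarrow> S \<subseteq> T \<Longrightarrow> poly_over T p"
  by (auto simp: poly_over_def intro: polyfun_subcoord_mono)

lemma polyfun_poly:
  assumes "poly_over S p"
  shows "polyfun (subcoord (insert j S)) (poly p (coordfun j))"
proof -
  have "polyfun (subcoord (insert j S)) (coeff p i)" for i
    using assms poly_over_mono[of S p "insert j S"] by (auto simp: poly_over_def)
  then show ?thesis
    unfolding poly_altdef
    by (intro polyfun_sum_fun polyfun_times polyfun_power polyfun_coordfun) auto
qed

lemma polyfun_insertE:
  assumes "polyfun (subcoord (insert j S)) f"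
  obtains p where "poly_over S p" "f = poly p (coordfun j)"
proof -
  have "\<exists>p. poly_over S p \<and> f = poly p (coordfun j)"
    using assms
  proof induction
    case (pf_const c)
    show ?case
      by (rule exI[of _ "[:(\<lambda>_. c):]"]) (auto intro!: poly_over_const polyfun.intros)
  next
    case (pf_coord i)
    show ?case
    proof (cases "i = j")
      case True
      then show ?thesis
        by (intro exI[of _ "monom 1 1"])
          (auto simp: poly_monom fun_eq_iff subcoord_def coordfun_def intro!: poly_over_monom polyfun_one)
    next
      case False
      then have "subcoord (insert j S) i = subcoord S i"
        by (auto simp: fun_eq_iff subcoord_def)
      then show ?thesis
        by (intro exI[of _ "[:subcoord S i:]"]) (auto intro!: poly_over_const polyfun.intros)
    qed
  next
    case (pf_add f g)
    then obtain p q where "poly_over S p" "f = poly p (coordfun j)"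
      "poly_over S q" "g = poly q (coordfun j)" by blast
    then show ?case
      by (intro exI[of _ "p + q"]) (auto simp: poly_over_add plus_fun_def)
  next
    case (pf_mult f g)
    then obtain p q where "poly_over S p" "f = poly p (coordfun j)"
      "poly_over S q" "g = poly q (coordfun j)" by blast
    then show ?case
      by (intro exI[of _ "p * q"]) (auto simp: poly_over_mult times_fun_def)
  qed
  then show ?thesis using that by blast
qed

text \<open>The leading coefficient of \<open>G\<close> need not be invertible, so \<open>P\<close>
  is multiplied by a power of it; each round cancels the top term. The bound on
  \<open>degree Q\<close> later lets the minimality of a relation apply to the quotient.\<close>

lemma pseudo_division:
  assumes G: "poly_over S G" "degree G > 0" and P: "poly_over S P"
  shows "\<exists>s Q R. smult (lead_coeff G ^ s) P = Q * G + R \<and> poly_over S Q \<and> poly_over S R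
           \<and> degree R < degree G \<and> degree Q \<le> degree P - degree G"
  using P
proof (induction "degree P" arbitrary: P rule: less_induct)
  case less
  show ?case
  proof (cases "degree P < degree G")
    case True
    moreover have "smult (lead_coeff G ^ 0) P = 0 * G + P" by simp
    ultimately show ?thesis using less.prems poly_over_0 degree_0 le0 by metis
  next
    case False
    let ?a = "lead_coeff P" and ?b = "lead_coeff G" and ?k = "degree P - degree G"
    define P' where "P' = smult ?b P - monom ?a ?k * G"
    have lc: "polyfun (subcoord S) ?a" "polyfun (subcoord S) ?b"
      using less.prems G by (auto simp: poly_over_def)
    have ov: "poly_over S P'" unfolding P'_def
      by (intro poly_over_intros lc G less.prems)
    have "degree P' \<le> degree P - 1"
    proof (rule degree_le, intro allI impI)
      fix i assume "degree P - 1 < i"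
      then consider "i = degree P" | "i > degree P" by linarith
      then show "coeff P' i = 0"
      proof cases
        case 1
        then show ?thesis using False mult.commute[of ?a ?b] by (simp add: P'_def coeff_monom_mult)
      next
        case 2
        then have "coeff G (i - ?k) = 0" by (intro coeff_eq_0) (use False in linarith)
        then show ?thesis using 2 by (simp add: P'_def coeff_monom_mult coeff_eq_0)
      qed
    qed
    then have "degree P' < degree P" using False G(2) by linarith
    from less.hyps[OF this ov] obtain s Q R where
      IH: "smult (?b ^ s) P' = Q * G + R" "poly_over S Q" "poly_over S R" "degree R < degree G"
        "degree Q \<le> degree P' - degree G"
      by blast
    have "degree (Q + smult (?b ^ s) (monom ?a ?k)) \<le> ?k"
      using IH(5) \<open>degree P' < degree P\<close>
      by (intro degree_add_le order.trans[OF degree_smult_le] degree_monom_le) linarith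
    have "smult (?b ^ Suc s) P = smult (?b ^ s) (P' + monom ?a ?k * G)"
      by (simp add: P'_def mult.commute)
    also have "\<dots> = (Q + smult (?b ^ s) (monom ?a ?k)) * G + R"
      using IH(1) by (simp add: smult_add_right algebra_simps)
    finally have "smult (?b ^ Suc s) P = (Q + smult (?b ^ s) (monom ?a ?k)) * G + R" .
    moreover have "poly_over S (Q + smult (?b ^ s) (monom ?a ?k))"
      by (intro poly_over_intros polyfun_power IH lc)
    ultimately show ?thesis
      using IH(3,4) \<open>degree (Q + smult (?b ^ s) (monom ?a ?k)) \<le> ?k\<close> by blast
  qed
qed

section \<open>Vanishing on irreducible varieties and minimal relations\<close>

definition vanishes_on :: "(complex^'n) set \<Rightarrow> (complex^'n \<Rightarrow> complex) \<Rightarrow> bool" where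
  "vanishes_on X f \<longleftrightarrow> (\<forall>x\<in>X. f x = 0)"

lemma vanishes_on_sum:
  "finite A \<Longrightarrow> (\<And>a. a \<in> A \<Longrightarrow> vanishes_on X (f a)) \<Longrightarrow> vanishes_on X (sum f A)"
  by (induction A rule: finite_induct) (auto simp: vanishes_on_def)

lemma zariski_closed_zeros:
  assumes "zariski_closed X" "polyfun cn_coord f"
  shows "zariski_closed {x \<in> X. f x = 0}"
proof -
  obtain F where F: "\<forall>f\<in>F. polyfun cn_coord f" "X = {x. \<forall>f\<in>F. f x = 0}"
    using assms(1) by (auto simp: zariski_closed_def)
  then show ?thesis unfolding zariski_closed_def
    by (intro exI[of _ "insert f F"]) (use assms(2) in auto)
qed

text \<open>The zero sets of \<open>f\<close> and \<open>g\<close> in \<open>X\<close> are closed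
  and cover \<open>X\<close>; in other words, the vanishing ideal is prime.\<close>

lemma irreducible_vanishes_mult:
  assumes X: "irreducible_variety X" and f: "polyfun cn_coord f" and g: "polyfun cn_coord g"
    and fg: "vanishes_on X (f * g)"
  shows "vanishes_on X f \<or> vanishes_on X g"
proof -
  let ?A = "{x\<in>X. f x = 0}" and ?B = "{x\<in>X. g x = 0}"
  have "zariski_closed ?A" "zariski_closed ?B"
    using X f g by (auto simp: irreducible_variety_def intro: zariski_closed_zeros)
  moreover have "X = ?A \<union> ?B" using fg by (auto simp: vanishes_on_def)
  ultimately have "X = ?A \<or> X = ?B" using X unfolding irreducible_variety_def by blast
  then show ?thesis by (auto simp: vanishes_on_def)
qed

lemma irreducible_vanishes_power:
  assumes X: "irreducible_variety X" and f: "polyfun cn_coord f" and "vanishes_on X (f ^ n)"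
  shows "vanishes_on X f"
  using assms(3)
  by (induction n)
    (use X irreducible_vanishes_mult[OF X f polyfun_power[OF f]] in
      \<open>auto simp: vanishes_on_def irreducible_variety_def\<close>)

lemma degree_minus_lead_monom:
  fixes p :: "'a::comm_ring_1 poly"
  assumes "degree p > 0"
  shows "degree (p - monom (lead_coeff p) (degree p)) < degree p"
proof -
  have "degree (p - monom (lead_coeff p) (degree p)) \<le> degree p - 1"
    by (rule degree_le) (auto simp: coeff_eq_0)
  then show ?thesis using assms by simp
qed

lemma poly_minus_lead_monom:
  assumes "vanishes_on X (lead_coeff p)" "x \<in> X"
  shows "poly (p - monom (lead_coeff p) (degree p)) (coordfun j) x = poly p (coordfun j) x"
  using assms by (simp add: poly_monom vanishes_on_def)

definition alg_indep_on :: "(complex^'n) set \<Rightarrow> 'n set \<Rightarrow> bool" where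
  "alg_indep_on X J \<longleftrightarrow> (\<forall>f. polyfun (subcoord J) f \<and> vanishes_on X f \<longrightarrow> f = 0)"

text \<open>The coordinate \<open>j\<close> is algebraic over those in \<open>S\<close> on
  \<open>X\<close>. Nontriviality is measured on \<open>X\<close>, since a nonzero polynomial
  coefficient may still vanish there.\<close>

definition relation_on :: "(complex^'n) set \<Rightarrow> 'n set \<Rightarrow> 'n \<Rightarrow> (complex^'n \<Rightarrow> complex) poly \<Rightarrow> bool" where
  "relation_on X S j p \<longleftrightarrow> poly_over S p \<and> vanishes_on X (poly p (coordfun j)) \<and>
     (\<exists>i. \<not> vanishes_on X (coeff p i))"

text \<open>A relation of least degree works: a leading term whose coefficient vanishes on
  \<open>X\<close> could be dropped, which would leave a relation of smaller degree.\<close>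

lemma minimal_relation:
  assumes "relation_on X S j p0"
  obtains p where "poly_over S p" "vanishes_on X (poly p (coordfun j))"
    "\<not> vanishes_on X (lead_coeff p)" "degree p > 0"
    "\<And>q i. poly_over S q \<Longrightarrow> vanishes_on X (poly q (coordfun j)) \<Longrightarrow> degree q < degree p \<Longrightarrow>
       vanishes_on X (coeff q i)"
proof -
  obtain p where p: "relation_on X S j p" and min: "\<And>q. relation_on X S j q \<Longrightarrow> degree p \<le> degree q"
    using ex_has_least_nat[of "relation_on X S j" p0 degree] assms by blast
  from p have p': "poly_over S p" "vanishes_on X (poly p (coordfun j))"
    by (auto simp: relation_on_def)
  obtain i where i: "\<not> vanishes_on X (coeff p i)" using p by (auto simp: relation_on_def)
  have deg: "degree p > 0"
  proof (rule ccontr)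
    assume "\<not> degree p > 0"
    then obtain c where c: "p = [:c:]" by (metis degree_eq_zeroE gr0I)
    with p'(2) have "vanishes_on X c" by simp
    then show False using i c by (cases i) (auto simp: vanishes_on_def coeff_pCons)
  qed
  have lc: "\<not> vanishes_on X (lead_coeff p)"
  proof
    assume v: "vanishes_on X (lead_coeff p)"
    define q where "q = p - monom (lead_coeff p) (degree p)"
    have dq: "degree q < degree p" unfolding q_def by (rule degree_minus_lead_monom[OF deg])
    have "vanishes_on X (poly q (coordfun j))"
      using p'(2) poly_minus_lead_monom[OF v] by (simp add: q_def vanishes_on_def)
    moreover have "poly_over S q" unfolding q_def using p'(1)
      by (intro poly_over_intros) (auto simp: poly_over_def)
    moreover have "i \<noteq> degree p" using i v by auto
    then have "coeff q i = coeff p i" by (simp add: q_def)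
    with i have "\<not> vanishes_on X (coeff q i)" by simp
    ultimately have "relation_on X S j q" by (auto simp: relation_on_def)
    from min[OF this] dq show False by simp
  qed
  show ?thesis
    by (rule that[OF p' lc deg]) (use min in \<open>force simp: relation_on_def\<close>)
qed

text \<open>The coordinate \<open>j\<close> being algebraic over the coordinates in \<open>S\<close>, a remainder of least
  degree among the multiples of \<open>g\<close> must be constant in that coordinate.\<close>

lemma divides_coefficient:
  assumes X: "irreducible_variety X" and rel: "relation_on X S j p0"
    and g: "polyfun (subcoord (insert j S)) g" "\<not> vanishes_on X g"
  shows "\<exists>h c. polyfun (subcoord S) c \<and> \<not> vanishes_on X c \<and> (\<forall>x\<in>X. g x * h x = c x)"
proof -
  obtain P where P: "poly_over S P" "vanishes_on X (poly P (coordfun j))"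
    "\<not> vanishes_on X (lead_coeff P)" "degree P > 0"
    and min: "\<And>q i. poly_over S q \<Longrightarrow> vanishes_on X (poly q (coordfun j)) \<Longrightarrow>
       degree q < degree P \<Longrightarrow> vanishes_on X (coeff q i)"
    using minimal_relation[OF rel] by blast
  let ?ev = "\<lambda>p x. poly p (coordfun j) x"
  \<comment> \<open>\<open>N r\<close> says that \<open>r\<close> represents on \<open>X\<close> a
    nonzero multiple of \<open>g\<close>. Only values on \<open>X\<close> count, so the cofactor
    \<open>h\<close> ranges over arbitrary functions.\<close>
  define N where "N r \<longleftrightarrow> poly_over S r \<and> \<not> vanishes_on X (?ev r) \<and>
     (\<exists>h. \<forall>x\<in>X. g x * h x = ?ev r x)" for r
  obtain G where G: "poly_over S G" "g = poly G (coordfun j)"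
    using g(1) by (rule polyfun_insertE)
  have "N G" using g(2) G by (auto simp: N_def intro!: exI[of _ "\<lambda>_. 1"])
  then obtain r where r: "N r" and rmin: "\<And>q. N q \<Longrightarrow> degree r \<le> degree q"
    using ex_has_least_nat[of N G degree] by blast
  from r obtain h where h: "poly_over S r" "\<not> vanishes_on X (?ev r)"
    "\<forall>x\<in>X. g x * h x = ?ev r x" by (auto simp: N_def)
  have polyf: "polyfun cn_coord (?ev q)" if "poly_over S q" for q
    using polyfun_subcoord_cn[OF polyfun_poly[OF that]] .
  have coeffp: "polyfun (subcoord S) (coeff q i)" if "poly_over S q" for q i
    using that by (auto simp: poly_over_def)
  have "degree r = 0"
  proof (rule ccontr)
    assume "degree r \<noteq> 0"
    then have rpos: "degree r > 0" by simp
    have lcr: "\<not> vanishes_on X (lead_coeff r)"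
    proof
      assume v: "vanishes_on X (lead_coeff r)"
      define q where "q = r - monom (lead_coeff r) (degree r)"
      have dq: "degree q < degree r" unfolding q_def by (rule degree_minus_lead_monom[OF rpos])
      have "\<forall>x\<in>X. ?ev q x = ?ev r x"
        unfolding q_def using poly_minus_lead_monom[OF v] by blast
      moreover have "poly_over S q" unfolding q_def using h(1)
        by (intro poly_over_intros) (auto simp: poly_over_def)
      ultimately have "N q" using h by (auto simp: N_def vanishes_on_def)
      from rmin[OF this] dq show False by simp
    qed
    \<comment> \<open>Otherwise division by \<open>P\<close>, which evaluates to zero on
      \<open>X\<close>, replaces \<open>r\<close> by a remainder of smaller degree that is still a
      nonzero multiple of \<open>g\<close>.\<close>
    have small: "degree r < degree P"
    proof (rule ccontr)
      assume ge: "\<not> degree r < degree P"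
      from pseudo_division[OF P(1,4) h(1)] obtain s Q R where
        d: "smult (lead_coeff P ^ s) r = Q * P + R" "poly_over S Q" "poly_over S R"
          "degree R < degree P" by blast
      have ev: "?ev R = lead_coeff P ^ s * ?ev r - ?ev Q * ?ev P"
        using arg_cong[OF d(1), of "\<lambda>p. poly p (coordfun j)"] by (simp add: algebra_simps)
      have eqX: "?ev R x = (lead_coeff P ^ s) x * ?ev r x" if "x \<in> X" for x
        using that P(2) by (simp add: ev vanishes_on_def)
      have "\<not> vanishes_on X (?ev R)"
      proof
        assume "vanishes_on X (?ev R)"
        then have "vanishes_on X (lead_coeff P ^ s * ?ev r)"
          using eqX by (auto simp: vanishes_on_def)
        then have "vanishes_on X (lead_coeff P ^ s) \<or> vanishes_on X (?ev r)"
          using irreducible_vanishes_mult[OF X polyfun_power polyf[OF h(1)]]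
            polyfun_subcoord_cn[OF coeffp[OF P(1)]] by blast
        then show False using h(2) P(3)
            irreducible_vanishes_power[OF X polyfun_subcoord_cn[OF coeffp[OF P(1)]]] by blast
      qed
      moreover have "\<forall>x\<in>X. g x * (h x * (lead_coeff P ^ s) x) = ?ev R x"
        using h(3) eqX by (simp add: mult.assoc[symmetric] mult.commute)
      ultimately have "N R" using d(3) unfolding N_def
        by (intro conjI exI[of _ "\<lambda>x. h x * (lead_coeff P ^ s) x"])
      from rmin[OF this] d(4) ge show False by simp
    qed
    \<comment> \<open>Now \<open>P\<close> is divided by \<open>r\<close>. The remainder is a
      multiple of \<open>g\<close> of smaller degree, so it vanishes on \<open>X\<close>. Hence so
      does the value of \<open>Q\<close>, and by minimality of \<open>P\<close> so do all
      coefficients of \<open>Q\<close>.\<close>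
    from pseudo_division[OF h(1) rpos P(1)] obtain s Q R where
      d: "smult (lead_coeff r ^ s) P = Q * r + R" "poly_over S Q" "poly_over S R"
        "degree R < degree r" "degree Q \<le> degree P - degree r" by blast
    have ev: "?ev R = lead_coeff r ^ s * ?ev P - ?ev Q * ?ev r"
      using arg_cong[OF d(1), of "\<lambda>p. poly p (coordfun j)"] by (simp add: algebra_simps)
    have eqX: "?ev R x = - (?ev Q x * ?ev r x)" if "x \<in> X" for x
      using that P(2) by (simp add: ev vanishes_on_def)
    have "\<exists>h. \<forall>x\<in>X. g x * h x = ?ev R x"
      by (rule exI[of _ "\<lambda>x. - (h x * ?ev Q x)"])
        (use h(3) eqX in \<open>simp add: mult.assoc[symmetric] mult.commute\<close>)
    then have "vanishes_on X (?ev R)"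
      using rmin[of R] d(3,4) unfolding N_def by (meson leD)
    then have "vanishes_on X (?ev Q * ?ev r)"
      using eqX by (auto simp: vanishes_on_def)
    then have vQ: "vanishes_on X (?ev Q)"
      using irreducible_vanishes_mult[OF X polyf[OF d(2)] polyf[OF h(1)]] h(2) by blast
    have "degree Q < degree P" using d(5) rpos small by linarith
    then have Qi: "vanishes_on X (coeff Q i)" for i
      using min[OF d(2) vQ] by blast
    \<comment> \<open>Comparing coefficients at \<open>degree P\<close> makes a product of leading
      coefficients vanish on \<open>X\<close>, although neither factor does.\<close>
    have "coeff R (degree P) = 0"
      using d(4) small by (intro coeff_eq_0) linarith
    then have "lead_coeff r ^ s * lead_coeff P = coeff (Q * r) (degree P)"
      using arg_cong[OF d(1), of "\<lambda>p. coeff p (degree P)"] by simp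
    moreover have "vanishes_on X (coeff (Q * r) (degree P))"
      unfolding coeff_mult using Qi by (intro vanishes_on_sum) (auto simp: vanishes_on_def)
    ultimately have "vanishes_on X (lead_coeff r ^ s * lead_coeff P)" by simp
    then have "vanishes_on X (lead_coeff r ^ s) \<or> vanishes_on X (lead_coeff P)"
      by (intro irreducible_vanishes_mult[OF X] polyfun_power polyfun_subcoord_cn[OF coeffp[OF h(1)]]
          polyfun_subcoord_cn[OF coeffp[OF P(1)]])
    then show False using P(3) lcr
        irreducible_vanishes_power[OF X polyfun_subcoord_cn[OF coeffp[OF h(1)]]] by blast
  qed
  then obtain c where c: "r = [:c:]" by (metis degree_eq_zeroE)
  show ?thesis
    using h coeffp[OF h(1), of 0] unfolding c by auto
qed

section \<open>Algebraic independence along chains of varieties\<close>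

lemma alg_indep_on_mono: "alg_indep_on Y J \<Longrightarrow> Y \<subseteq> X \<Longrightarrow> alg_indep_on X J"
  by (auto simp: alg_indep_on_def vanishes_on_def)

text \<open>Maximality of \<open>J\<close> makes each coordinate outside \<open>J\<close> algebraic,
  so \<open>divides_coefficient\<close> eliminates the coordinates in \<open>T\<close> one at a
  time; the cofactors are multiplied.\<close>

lemma divides_independent:
  assumes X: "irreducible_variety X" and J: "alg_indep_on X J"
    and dep: "\<And>j. j \<notin> J \<Longrightarrow> \<not> alg_indep_on X (insert j J)"
    and "finite T" and g: "polyfun (subcoord (J \<union> T)) g" "\<not> vanishes_on X g"
  shows "\<exists>h c. polyfun (subcoord J) c \<and> \<not> vanishes_on X c \<and> (\<forall>x\<in>X. g x * h x = c x)"
  using \<open>finite T\<close> g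
proof (induction T arbitrary: g rule: finite_induct)
  case empty
  then show ?case by (intro exI[of _ "\<lambda>_. 1"] exI[of _ g]) auto
next
  case (insert j T)
  show ?case
  proof (cases "j \<in> J")
    case True
    then have "J \<union> insert j T = J \<union> T" by blast
    then show ?thesis using insert by simp
  next
    case False
    from dep[OF this] obtain f where f: "polyfun (subcoord (insert j J)) f" "vanishes_on X f" "f \<noteq> 0"
      by (auto simp: alg_indep_on_def)
    obtain p where p: "poly_over J p" "f = poly p (coordfun j)"
      using f(1) by (rule polyfun_insertE)
    \<comment> \<open>Independence of \<open>J\<close> turns a nonzero coefficient into one that
      does not vanish on \<open>X\<close>, as \<open>relation_on\<close> requires.\<close>
    have "p \<noteq> 0" using f(3) p(2) by auto
    then have "lead_coeff p \<noteq> 0" by simp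
    then have "\<not> vanishes_on X (lead_coeff p)"
      using J p(1) unfolding alg_indep_on_def poly_over_def by blast
    then have "relation_on X (J \<union> T) j p"
      using p f(2) poly_over_mono[OF p(1), of "J \<union> T"] by (auto simp: relation_on_def)
    moreover have "polyfun (subcoord (insert j (J \<union> T))) g" using insert.prems by simp
    ultimately obtain h c where hc: "polyfun (subcoord (J \<union> T)) c" "\<not> vanishes_on X c"
      "\<forall>x\<in>X. g x * h x = c x"
      using divides_coefficient[OF X] insert.prems(2) by blast
    from insert.IH[OF hc(1,2)] obtain h' c' where
      "polyfun (subcoord J) c'" "\<not> vanishes_on X c'" "\<forall>x\<in>X. c x * h' x = c' x" by blast
    then show ?thesis using hc(3)
      by (intro exI[of _ "\<lambda>x. h x * h' x"] exI[of _ c']) (simp add: mult.assoc[symmetric])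
  qed
qed

text \<open>If no coordinate could be added, a function vanishing on \<open>Y\<close> but not on
  \<open>X\<close> would divide, on \<open>X\<close>, a nonzero polynomial in the coordinates of
  \<open>J\<close>. That polynomial vanishes on \<open>Y\<close>, against the independence of
  \<open>J\<close> there.\<close>

lemma alg_indep_on_extend:
  assumes X: "irreducible_variety X" and Y: "zariski_closed Y" "Y \<subset> X" and J: "alg_indep_on Y J"
  shows "\<exists>j. j \<notin> J \<and> alg_indep_on X (insert j J)"
proof (rule ccontr)
  assume no: "\<nexists>j. j \<notin> J \<and> alg_indep_on X (insert j J)"
  obtain F where F: "\<forall>f\<in>F. polyfun cn_coord f" "Y = {x. \<forall>f\<in>F. f x = 0}"
    using Y(1) by (auto simp: zariski_closed_def)
  obtain g where g: "polyfun cn_coord g" "vanishes_on Y g" "\<not> vanishes_on X g"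
    using F Y(2) unfolding vanishes_on_def by blast
  have JX: "alg_indep_on X J" using alg_indep_on_mono[OF J] Y(2) by blast
  have "polyfun (subcoord (J \<union> UNIV)) g" using g(1) by (simp add: subcoord_UNIV)
  with divides_independent[OF X JX] no g(3) obtain h c where
    c: "polyfun (subcoord J) c" "\<not> vanishes_on X c" "\<forall>x\<in>X. g x * h x = c x"
    by (metis finite_code)
  have "vanishes_on Y c" unfolding vanishes_on_def
  proof
    fix x assume "x \<in> Y"
    then show "c x = 0" using c(3) g(2) Y(2) unfolding vanishes_on_def
      by (metis mult_zero_left psubsetD)
  qed
  then have "c = 0" using J c(1) by (auto simp: alg_indep_on_def)
  then show False using c(2) by (auto simp: vanishes_on_def)
qed

lemma alg_indep_on_chain:
  assumes "\<forall>i\<le>k. irreducible_variety (Y i)" and "\<forall>i<k. Y i \<subset> Y (Suc i)"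
  shows "\<exists>J. card J = k \<and> alg_indep_on (Y k) J"
  using assms
proof (induction k)
  case 0
  then obtain y where "y \<in> Y 0" by (auto simp: irreducible_variety_def)
  then have "alg_indep_on (Y 0) {}"
    by (auto simp: alg_indep_on_def vanishes_on_def fun_eq_iff dest!: polyfun_subcoord_empty)
  then show ?case by (intro exI[of _ "{}"]) auto
next
  case (Suc k)
  then obtain J where J: "card J = k" "alg_indep_on (Y k) J" by auto
  have "irreducible_variety (Y (Suc k))" "zariski_closed (Y k)" "Y k \<subset> Y (Suc k)"
    using Suc.prems by (auto simp: irreducible_variety_def)
  from alg_indep_on_extend[OF this J(2)] obtain j where
    "j \<notin> J" "alg_indep_on (Y (Suc k)) (insert j J)" by blast
  then show ?case using J(1) by (intro exI[of _ "insert j J"]) (simp add: card_insert_if)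
qed

section \<open>Gradients of polynomial functions\<close>

lemma bilin_add_left: "bilin (a + b) v = bilin a v + bilin b v"
  and bilin_add_right: "bilin v (a + b) = bilin v a + bilin v b"
  and bilin_scale_left: "bilin (c *s a) v = c * bilin a v"
  and bilin_scale_right: "bilin v (c *s a) = c * bilin v a"
  and bilin_axis: "bilin a (axis i 1) = a $ i"
  and bilin_axis_left: "bilin (axis i 1) a = a $ i"
  and bilin_zero_left: "bilin 0 v = 0"
  by (simp_all add: bilin_def algebra_simps sum.distrib sum_distrib_left axis_def if_distrib if_distribR
      cong: if_cong)

text \<open>\<open>grad_at\<close> is built from \<open>deriv\<close>, which is meaningful only for
  differentiable functions. Induction supplies a polynomial gradient together with all directional
  derivatives; \<open>grad_at_eqI\<close> then identifies it with \<open>grad_at\<close>.\<close>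

lemma polyfun_gradient:
  fixes f :: "complex^'n \<Rightarrow> complex"
  assumes "polyfun cn_coord f"
  shows "\<exists>G. (\<forall>i. polyfun cn_coord (\<lambda>x. G x $ i)) \<and>
     (\<forall>x v. ((\<lambda>t. f (x + t *s v)) has_field_derivative bilin (G x) v) (at 0))"
  using assms
proof induction
  case (pf_const c)
  show ?case by (intro exI[of _ "\<lambda>_. 0"]) (auto intro: polyfun.intros simp: bilin_zero_left)
next
  case (pf_coord i)
  show ?case
    by (intro exI[of _ "\<lambda>_. axis i 1"])
      (auto simp: cn_coord_def bilin_axis_left intro!: derivative_eq_intros polyfun.pf_const)
next
  case (pf_add f g)
  then obtain F G where F: "\<forall>i. polyfun cn_coord (\<lambda>x. F x $ i)"
      "\<forall>x v. ((\<lambda>t. f (x + t *s v)) has_field_derivative bilin (F x) v) (at 0)"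
    and G: "\<forall>i. polyfun cn_coord (\<lambda>x. G x $ i)"
      "\<forall>x v. ((\<lambda>t. g (x + t *s v)) has_field_derivative bilin (G x) v) (at 0)" by blast
  then show ?case
    by (intro exI[of _ "\<lambda>x. F x + G x"])
      (auto simp: bilin_add_left intro!: polyfun.pf_add derivative_intros)
next
  case (pf_mult f g)
  then obtain F G where F: "\<forall>i. polyfun cn_coord (\<lambda>x. F x $ i)"
      "\<forall>x v. ((\<lambda>t. f (x + t *s v)) has_field_derivative bilin (F x) v) (at 0)"
    and G: "\<forall>i. polyfun cn_coord (\<lambda>x. G x $ i)"
      "\<forall>x v. ((\<lambda>t. g (x + t *s v)) has_field_derivative bilin (G x) v) (at 0)" by blast
  have "((\<lambda>t. f (x + t *s v) * g (x + t *s v)) has_field_derivative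
      bilin (g x *s F x + f x *s G x) v) (at 0)" for x v
    using DERIV_mult[OF F(2)[rule_format, of x v] G(2)[rule_format, of x v]]
    by (simp add: bilin_add_left bilin_scale_left mult.commute)
  then show ?case
    by (intro exI[of _ "\<lambda>x. g x *s F x + f x *s G x"])
      (auto intro!: polyfun.pf_add polyfun.pf_mult pf_mult.hyps F(1)[rule_format] G(1)[rule_format])
qed

lemma grad_at_eqI:
  assumes "\<And>v. ((\<lambda>t. f (x + t *s v)) has_field_derivative bilin g v) (at 0)"
  shows "grad_at f x = g"
  using DERIV_imp_deriv[OF assms]
  by (simp add: grad_at_def pderiv_at_def vec_eq_iff bilin_axis)

lemma has_derivative_grad:
  assumes "polyfun cn_coord f"
  shows "((\<lambda>t. f (x + t *s v)) has_field_derivative bilin (grad_at f x) v) (at 0)"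
proof -
  obtain G where G: "\<forall>x v. ((\<lambda>t. f (x + t *s v)) has_field_derivative bilin (G x) v) (at 0)"
    using polyfun_gradient[OF assms] by blast
  then show ?thesis using grad_at_eqI[of f x "G x"] by simp
qed

lemma polyfun_grad_at:
  assumes "polyfun cn_coord f"
  shows "polyfun cn_coord (\<lambda>x. grad_at f x $ i)"
proof -
  obtain G where G: "\<forall>i. polyfun cn_coord (\<lambda>x. G x $ i)"
    "\<forall>x v. ((\<lambda>t. f (x + t *s v)) has_field_derivative bilin (G x) v) (at 0)"
    using polyfun_gradient[OF assms] by blast
  then have "grad_at f x = G x" for x using grad_at_eqI[of f x "G x"] by simp
  then show ?thesis using G(1) by simp
qed

lemma grad_at_0: "grad_at 0 x = 0"
  by (rule grad_at_eqI) (simp add: bilin_zero_left)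

lemma grad_at_add:
  assumes "polyfun cn_coord f" "polyfun cn_coord g"
  shows "grad_at (f + g) x = grad_at f x + grad_at g x"
  using assms
  by (intro grad_at_eqI) (auto simp: bilin_add_left intro!: derivative_intros has_derivative_grad)

lemma grad_at_mult:
  assumes "polyfun cn_coord f" "polyfun cn_coord g"
  shows "grad_at (f * g) x = g x *s grad_at f x + f x *s grad_at g x"
proof (rule grad_at_eqI)
  fix v
  show "((\<lambda>t. (f * g) (x + t *s v)) has_field_derivative
      bilin (g x *s grad_at f x + f x *s grad_at g x) v) (at 0)"
    using DERIV_mult[OF has_derivative_grad[OF assms(1), of x v] has_derivative_grad[OF assms(2), of x v]]
    by (simp add: bilin_add_left bilin_scale_left mult.commute)
qed

section \<open>The rank of the Jacobian\<close>

text \<open>By the Leibniz rule the derivative of a term falls either on its coefficient, giving a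
  vector in \<open>W\<close>, or on a power of the coordinate, where the coefficient is zero at
  \<open>x\<close>. The value at \<open>x\<close> is carried along because the inductive step, in
  Horner form, multiplies by it.\<close>

lemma grad_at_poly_in_subspace:
  assumes W: "vec.subspace W" and p: "poly_over S p"
    and "\<And>i. coeff p i x = 0" and "\<And>i. grad_at (coeff p i) x \<in> W"
  shows "poly p (coordfun j) x = 0 \<and> grad_at (poly p (coordfun j)) x \<in> W"
  using p assms(3,4)
proof (induction p)
  case 0
  then show ?case using vec.subspace_0[OF W] by (simp add: grad_at_0)
next
  case (pCons a p)
  have over: "polyfun (subcoord S) a" "poly_over S p"
    using pCons.prems(1)[unfolded poly_over_def, rule_format, of 0]
      pCons.prems(1)[unfolded poly_over_def, rule_format, of "Suc _"]
    by (auto simp: poly_over_def)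
  have IH: "poly p (coordfun j) x = 0 \<and> grad_at (poly p (coordfun j)) x \<in> W"
    using pCons.IH[OF over(2)] pCons.prems(2)[of "Suc _"] pCons.prems(3)[of "Suc _"] by simp
  have a: "a x = 0" "grad_at a x \<in> W" using pCons.prems(2,3)[of 0] by auto
  have pf: "polyfun cn_coord a" "polyfun cn_coord (coordfun j)"
    "polyfun cn_coord (poly p (coordfun j))"
    using polyfun_subcoord_cn[OF over(1)] polyfun_subcoord_cn[OF polyfun_poly[OF over(2)]]
      polyfun_subcoord_cn[OF polyfun_coordfun[of j UNIV]] by auto
  have "grad_at (poly (pCons a p) (coordfun j)) x =
      grad_at a x + coordfun j x *s grad_at (poly p (coordfun j)) x"
    using pf IH by (simp add: grad_at_add grad_at_mult polyfun_times)
  then have "grad_at (poly (pCons a p) (coordfun j)) x \<in> W"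
    using a IH W by (simp only: vec.subspace_add vec.subspace_scale)
  moreover have "poly (pCons a p) (coordfun j) x = 0" using a IH by simp
  ultimately show ?case by blast
qed

text \<open>The coordinates in \<open>T\<close> are adjoined one at a time. A coordinate that is transcendental
  over the previous ones contributes nothing, since all coefficients of a relation vanish on \<open>X\<close>;
  for an algebraic one, pseudo-division by a minimal relation shows that the gradient of that
  single relation suffices, as long as its leading coefficient does not vanish.\<close>

lemma generic_gradient_span:
  fixes X :: "(complex^'n) set"
  assumes X: "irreducible_variety X" and J: "alg_indep_on X J" and "finite T"
  shows "\<exists>a. polyfun cn_coord a \<and> \<not> vanishes_on X a \<and>
    (\<forall>x\<in>X. a x \<noteq> 0 \<longrightarrow> (\<exists>V. finite V \<and> card V \<le> card T \<and>
       (\<forall>f. polyfun (subcoord (J \<union> T)) f \<and> vanishes_on X f \<longrightarrow> grad_at f x \<in> vec.span V)))"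
  using \<open>finite T\<close>
proof (induction T rule: finite_induct)
  case empty
  have "grad_at f x \<in> vec.span {}" if "polyfun (subcoord J) f" "vanishes_on X f" for f x
    using J that by (auto simp: alg_indep_on_def grad_at_0)
  then have "\<exists>V. finite V \<and> card V \<le> card ({} :: 'n set) \<and>
     (\<forall>f. polyfun (subcoord (J \<union> {})) f \<and> vanishes_on X f \<longrightarrow> grad_at f x \<in> vec.span V)" for x
    by (intro exI[of _ "{}"]) simp
  moreover have "\<not> vanishes_on X 1" using X by (auto simp: vanishes_on_def irreducible_variety_def)
  ultimately show ?case using polyfun_one by blast
next
  case (insert j T)
  define S where "S = J \<union> T"
  have S': "J \<union> insert j T = insert j S" by (simp add: S_def)
  from insert.IH obtain a where a: "polyfun cn_coord a" "\<not> vanishes_on X a"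
    and aV: "\<And>x. x \<in> X \<Longrightarrow> a x \<noteq> 0 \<Longrightarrow> \<exists>V. finite V \<and> card V \<le> card T \<and>
       (\<forall>f. polyfun (subcoord S) f \<and> vanishes_on X f \<longrightarrow> grad_at f x \<in> vec.span V)"
    unfolding S_def by blast
  let ?ev = "\<lambda>p. poly p (coordfun j)"
  have polyf: "polyfun cn_coord (?ev q)" if "poly_over S q" for q
    using polyfun_subcoord_cn[OF polyfun_poly[OF that]] .
  have coeffp: "polyfun (subcoord S) (coeff q i)" if "poly_over S q" for q i
    using that by (auto simp: poly_over_def)
  have grad_ev: "grad_at (?ev p) x \<in> vec.span V"
    if "x \<in> X" "poly_over S p" "\<And>i. vanishes_on X (coeff p i)"
      "\<forall>f. polyfun (subcoord S) f \<and> vanishes_on X f \<longrightarrow> grad_at f x \<in> vec.span V" for x V p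
    using grad_at_poly_in_subspace[OF vec.subspace_span[of V] that(2), of x j] that coeffp[OF that(2)]
    by (auto simp: vanishes_on_def)
  show ?case
  proof (cases "\<exists>p. relation_on X S j p")
    case False
    show ?thesis unfolding S'
    proof (intro exI[of _ a] conjI a ballI impI)
      fix x assume x: "x \<in> X" "a x \<noteq> 0"
      from aV[OF this] obtain V where V: "finite V" "card V \<le> card T"
        "\<forall>f. polyfun (subcoord S) f \<and> vanishes_on X f \<longrightarrow> grad_at f x \<in> vec.span V" by blast
      have "grad_at f x \<in> vec.span V"
        if f: "polyfun (subcoord (insert j S)) f" "vanishes_on X f" for f
      proof -
        obtain p where p: "poly_over S p" "f = ?ev p" using f(1) by (rule polyfun_insertE)
        then have "vanishes_on X (coeff p i)" for i
          using False f(2) by (auto simp: relation_on_def)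
        then show ?thesis using grad_ev[OF x(1) p(1) _ V(3)] p(2) by blast
      qed
      then show "\<exists>V. finite V \<and> card V \<le> card (insert j T) \<and>
          (\<forall>f. polyfun (subcoord (insert j S)) f \<and> vanishes_on X f \<longrightarrow> grad_at f x \<in> vec.span V)"
        using V insert.hyps by (intro exI[of _ V]) auto
    qed
  next
    case True
    then obtain P where P: "poly_over S P" "vanishes_on X (?ev P)"
      "\<not> vanishes_on X (lead_coeff P)" "degree P > 0"
      and min: "\<And>q i. poly_over S q \<Longrightarrow> vanishes_on X (?ev q) \<Longrightarrow>
         degree q < degree P \<Longrightarrow> vanishes_on X (coeff q i)"
      using minimal_relation by blast
    let ?b = "lead_coeff P"
    have b: "polyfun cn_coord ?b" using polyfun_subcoord_cn[OF coeffp[OF P(1)]] .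
    show ?thesis unfolding S'
    proof (intro exI[of _ "a * ?b"] conjI ballI impI)
      show "polyfun cn_coord (a * ?b)" by (intro polyfun_times a b)
      show "\<not> vanishes_on X (a * ?b)"
        using irreducible_vanishes_mult[OF X a(1) b] a(2) P(3) by blast
      fix x assume x: "x \<in> X" "(a * ?b) x \<noteq> 0"
      then have bx: "?b x \<noteq> 0" by simp
      from aV[OF x(1)] x(2) obtain V where V: "finite V" "card V \<le> card T"
        "\<forall>f. polyfun (subcoord S) f \<and> vanishes_on X f \<longrightarrow> grad_at f x \<in> vec.span V" by auto
      let ?V = "insert (grad_at (?ev P) x) V"
      have "grad_at f x \<in> vec.span ?V"
        if f: "polyfun (subcoord (insert j S)) f" "vanishes_on X f" for f
      proof -
        obtain p where p: "poly_over S p" "f = ?ev p" using f(1) by (rule polyfun_insertE)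
        from pseudo_division[OF P(1,4) p(1)] obtain s Q R where
          d: "smult (?b ^ s) p = Q * P + R" "poly_over S Q" "poly_over S R" "degree R < degree P"
          by blast
        have ev: "?b ^ s * f = ?ev Q * ?ev P + ?ev R"
          using arg_cong[OF d(1), of ?ev] by (simp add: p(2))
        have "?ev R y = 0" if "y \<in> X" for y
          using fun_cong[OF ev, of y] that f(2) P(2) by (simp add: vanishes_on_def)
        then have "vanishes_on X (?ev R)" by (simp add: vanishes_on_def)
        then have "vanishes_on X (coeff R i)" for i using min[OF d(3)] d(4) by blast
        then have "grad_at (?ev R) x \<in> vec.span V" using grad_ev[OF x(1) d(3) _ V(3)] by blast
        then have R: "grad_at (?ev R) x \<in> vec.span ?V"
          using vec.span_mono[of V ?V] by blast
        have "grad_at (?b ^ s * f) x = grad_at (?ev Q * ?ev P + ?ev R) x" using ev by simp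
        \<comment> \<open>In the product rule the terms with a factor \<open>f x\<close> or
          \<open>?ev P x\<close> drop out, since both values are zero.\<close>
        then have "(?b ^ s) x *s grad_at f x = ?ev Q x *s grad_at (?ev P) x + grad_at (?ev R) x"
          using f(2) x(1) P(2) b polyfun_subcoord_cn[OF f(1)] polyf P(1) d(2,3)
          by (simp add: grad_at_mult grad_at_add polyfun_times polyfun_power vanishes_on_def)
        then have "(?b ^ s) x *s grad_at f x \<in> vec.span ?V"
          using R by (simp add: vec.span_add vec.span_scale vec.span_base)
        then have "inverse ((?b ^ s) x) *s ((?b ^ s) x *s grad_at f x) \<in> vec.span ?V"
          by (rule vec.span_scale)
        then show ?thesis using bx by (simp add: power_fun_apply)
      qed
      moreover have "card ?V \<le> card (insert j T)"
        using V insert.hyps by (simp add: card_insert_if)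
      ultimately show "\<exists>V. finite V \<and> card V \<le> card (insert j T) \<and>
          (\<forall>f. polyfun (subcoord (insert j S)) f \<and> vanishes_on X f \<longrightarrow> grad_at f x \<in> vec.span V)"
        using V(1) by (intro exI[of _ ?V]) auto
    qed
  qed
qed

lemma var_ideal_iff: "f \<in> var_ideal X \<longleftrightarrow> polyfun cn_coord f \<and> vanishes_on X f"
  by (auto simp: var_ideal_def vanishes_on_def)

lemma polyfun_det:
  assumes "\<And>i j. polyfun coord (\<lambda>x. M x $ i $ j)"
  shows "polyfun coord (\<lambda>x. det (M x))"
  unfolding det_def by (intro polyfun_sum pf_mult pf_const polyfun_prod assms) auto

text \<open>The bound holds generically by \<open>generic_gradient_span\<close>; the rank of the Jacobian is
  lower semicontinuous, so it cannot be larger at a special point.\<close>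

lemma card_alg_indep_rank:
  fixes X :: "(complex^'n) set"
  assumes X: "irreducible_variety X" and J: "alg_indep_on X J" and x: "x \<in> X"
  shows "card J + vec.dim (jac_rows X x) \<le> CARD('n)"
proof -
  obtain B0 where B0: "B0 \<subseteq> jac_rows X x" "vec.independent B0" "card B0 = vec.dim (jac_rows X x)"
    by (rule vec.basis_exists)
  define B where "B = vec.extend_basis B0"
  have B: "B0 \<subseteq> B" "vec.independent B" "vec.span B = UNIV"
    using vec.extend_basis_superset[OF B0(2)] vec.independent_extend_basis[OF B0(2)]
      vec.span_extend_basis[OF B0(2)] by (auto simp: B_def)
  have finB: "finite B" using B(2) vec.finiteI_independent by blast
  have cB: "card B = CARD('n)"
    using vec.dim_eq_card[of B UNIV] B by (simp add: vec.dim_UNIV card_cart_basis)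
  \<comment> \<open>The basis is indexed by the coordinates so that its members can be the rows of a
    square matrix.\<close>
  obtain h where h: "bij_betw h (UNIV :: 'n set) B"
    using finite_same_card_bij[of "UNIV :: 'n set" B] finB cB by auto
  define I where "I = {i. h i \<in> B0}"
  have "\<forall>i\<in>I. \<exists>f. f \<in> var_ideal X \<and> grad_at f x = h i"
    using B0(1) by (fastforce simp: I_def jac_rows_def)
  then obtain f where f: "\<And>i. i \<in> I \<Longrightarrow> f i \<in> var_ideal X" "\<And>i. i \<in> I \<Longrightarrow> grad_at (f i) x = h i"
    by metis
  \<comment> \<open>The gradients move with \<open>y\<close> while the added basis vectors stay
    fixed. Thus \<open>det (M y)\<close> is polynomial in \<open>y\<close>, nonzero at
    \<open>x\<close>, and wherever it is nonzero the chosen gradients are independent.\<close>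
  define M where "M y = (\<chi> i. if i \<in> I then grad_at (f i) y else h i)" for y
  have rowM: "row i (M y) = (if i \<in> I then grad_at (f i) y else h i)" for i y
    by (auto simp: M_def row_def vec_eq_iff)
  have Mpoly: "polyfun cn_coord (\<lambda>y. det (M y))"
  proof (rule polyfun_det)
    fix i j show "polyfun cn_coord (\<lambda>y. M y $ i $ j)"
      using f(1)[of i]
      by (cases "i \<in> I") (auto simp: M_def var_ideal_iff intro: polyfun_grad_at polyfun.pf_const)
  qed
  have "det (M x) \<noteq> 0"
  proof -
    have "row i (M x) = h i" for i by (simp add: rowM f(2))
    moreover have "\<forall>i. c i = 0" if "(\<Sum>i\<in>UNIV. c i *s h i) = 0" for c
    proof -
      have "(\<Sum>b\<in>B. c (inv_into UNIV h b) *s b) = (\<Sum>i\<in>UNIV. c i *s h i)"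
        using h by (subst sum.reindex_bij_betw[OF h, symmetric]) (simp add: bij_betw_def)
      then have "c (inv_into UNIV h b) = 0" if "b \<in> B" for b
        using vec.independentD[OF B(2) finB subset_refl] that \<open>_ = 0\<close> by simp
      then show ?thesis using h by (metis UNIV_I bij_betw_def imageI inv_into_f_f)
    qed
    ultimately have "\<exists>N. M x ** N = mat 1"
      by (simp add: matrix_right_invertible_independent_rows)
    then show ?thesis by (simp add: invertible_det_nz[symmetric] invertible_right_inverse)
  qed
  then have Mnz: "\<not> vanishes_on X (\<lambda>y. det (M y))" using x by (auto simp: vanishes_on_def)
  \<comment> \<open>Taking \<open>- J\<close> as the adjoined set exhausts all coordinates, so the
    generic bound covers the whole ideal.\<close>
  obtain a where a: "polyfun cn_coord a" "\<not> vanishes_on X a"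
    and aV: "\<forall>y\<in>X. a y \<noteq> 0 \<longrightarrow> (\<exists>V. finite V \<and> card V \<le> card (- J) \<and>
       (\<forall>f. polyfun (subcoord (J \<union> - J)) f \<and> vanishes_on X f \<longrightarrow> grad_at f y \<in> vec.span V))"
    using generic_gradient_span[OF X J, of "- J"] by auto
  have "\<not> vanishes_on X (a * (\<lambda>y. det (M y)))"
    using irreducible_vanishes_mult[OF X a(1) Mpoly] a(2) Mnz by blast
  then obtain y where y: "y \<in> X" "a y \<noteq> 0" "det (M y) \<noteq> 0" by (auto simp: vanishes_on_def)
  then obtain V where V: "finite V" "card V \<le> card (- J)"
    "\<And>f. f \<in> var_ideal X \<Longrightarrow> grad_at f y \<in> vec.span V"
    using aV by (auto simp: var_ideal_iff subcoord_UNIV)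
  have indrows: "c i = 0" if "(\<Sum>i\<in>UNIV. c i *s row i (M y)) = 0" for c i
    using y(3) that unfolding invertible_det_nz[symmetric] invertible_right_inverse
      matrix_right_invertible_independent_rows by blast
  let ?g = "\<lambda>i. grad_at (f i) y"
  have inj: "inj_on ?g I"
  proof (rule inj_onI, rule ccontr)
    fix i k assume ik: "i \<in> I" "k \<in> I" "?g i = ?g k" "i \<noteq> k"
    let ?c = "\<lambda>l. if l = i then 1 else if l = k then - 1 else 0 :: complex"
    have "(\<Sum>l\<in>UNIV. ?c l *s row l (M y)) = (\<Sum>l\<in>{i,k}. ?c l *s row l (M y))"
      by (rule sum.mono_neutral_right) auto
    also have "\<dots> = 0" using ik by (simp add: rowM)
    finally show False using indrows[of ?c i] by simp
  qed
  have "vec.independent (?g ` I)"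
  proof (rule vec.independent_if_scalars_zero)
    fix u v assume u: "(\<Sum>v\<in>?g ` I. u v *s v) = 0" and v: "v \<in> ?g ` I"
    let ?c = "\<lambda>i. if i \<in> I then u (?g i) else 0"
    have "(\<Sum>i\<in>UNIV. ?c i *s row i (M y)) = (\<Sum>i\<in>I. ?c i *s row i (M y))"
      by (rule sum.mono_neutral_right) auto
    also have "\<dots> = (\<Sum>i\<in>I. u (?g i) *s ?g i)" by (simp add: rowM)
    also have "\<dots> = 0" using u by (simp add: sum.reindex[OF inj])
    finally have c: "?c i = 0" for i by (rule indrows)
    from v obtain i where "i \<in> I" "v = ?g i" by blast
    then show "u v = 0" using c[of i] by simp
  qed auto
  moreover have "?g ` I \<subseteq> vec.span V" using V(3) f(1) by blast
  ultimately have "card (?g ` I) \<le> card V" using vec.independent_span_bound[OF V(1)] by blast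
  then have "card I \<le> card (- J)" using V(2) by (simp add: card_image[OF inj])
  moreover have "card I = card B0"
  proof -
    have "h ` I = B0" using h B(1) by (auto simp: I_def bij_betw_def)
    moreover have "inj_on h I" using h by (auto simp: bij_betw_def inj_on_def)
    ultimately show ?thesis using card_image by metis
  qed
  moreover have "card J + card (- J) = CARD('n)"
    by (metis card_Un_disjoint Compl_disjoint Compl_partition finite_code)
  ultimately show ?thesis using B0(3) by simp
qed

section \<open>Dimension as the maximal length of a chain\<close>

definition variety_chain :: "(complex^'n) set \<Rightarrow> (nat \<Rightarrow> (complex^'n) set) \<Rightarrow> nat \<Rightarrow> bool" where
  "variety_chain X Y k \<longleftrightarrow> (\<forall>i\<le>k. irreducible_variety (Y i) \<and> Y i \<subseteq> X) \<and> (\<forall>i<k. Y i \<subset> Y (Suc i))"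

text \<open>Coordinates independent on the top member of the chain stay independent on the larger
  \<open>X\<close>, where the Jacobian rank limits their number.\<close>

lemma variety_chain_bound:
  fixes X :: "(complex^'n) set"
  assumes X: "irreducible_variety X" and x: "x \<in> X" and Y: "variety_chain X Y k"
  shows "k + vec.dim (jac_rows X x) \<le> CARD('n)"
proof -
  obtain J where J: "card J = k" "alg_indep_on (Y k) J"
    using alg_indep_on_chain[of k Y] Y by (auto simp: variety_chain_def)
  then have "alg_indep_on X J"
    using alg_indep_on_mono[OF J(2), of X] Y by (simp add: variety_chain_def)
  from card_alg_indep_rank[OF X this x] J(1) show ?thesis by simp
qed

lemma var_dim_eq: "var_dim X = Sup {k. \<exists>Y. variety_chain X Y k}"
  by (simp add: var_dim_def variety_chain_def)

text \<open>On natural numbers \<open>Sup\<close> is a maximum only for nonempty bounded sets; this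
  bound makes \<open>var_dim\<close> an attained chain length.\<close>

lemma variety_chain_bdd:
  fixes X :: "(complex^'n) set"
  assumes X: "irreducible_variety X"
  shows "bdd_above {k. \<exists>Y. variety_chain X Y k}"
proof -
  obtain x where x: "x \<in> X" using X by (auto simp: irreducible_variety_def)
  show ?thesis
    using variety_chain_bound[OF X x] by (intro bdd_aboveI[of _ "CARD('n)"]) fastforce
qed

lemma variety_chain_var_dim:
  assumes X: "irreducible_variety X"
  shows "\<exists>Y. variety_chain X Y (var_dim X)"
proof -
  have "variety_chain X (\<lambda>_. X) 0" using X by (simp add: variety_chain_def)
  then have "{k. \<exists>Y. variety_chain X Y k} \<noteq> {}" by blast
  then have "var_dim X \<in> {k. \<exists>Y. variety_chain X Y k}"
    unfolding var_dim_eq Sup_nat_def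
    using Max_in[of "{k. \<exists>Y. variety_chain X Y k}"] variety_chain_bdd[OF X]
    by (simp add: bdd_above_nat)
  then show ?thesis by blast
qed

lemma var_dim_rank:
  fixes X :: "(complex^'n) set"
  assumes "irreducible_variety X" "x \<in> X"
  shows "var_dim X + vec.dim (jac_rows X x) \<le> CARD('n)"
  using variety_chain_var_dim[OF assms(1)] variety_chain_bound[OF assms] by blast

lemma var_dim_less:
  assumes X: "irreducible_variety X" and L: "irreducible_variety L" and XL: "X \<subset> L"
  shows "var_dim X < var_dim L"
proof -
  obtain Y where Y: "variety_chain X Y (var_dim X)" using variety_chain_var_dim[OF X] by blast
  \<comment> \<open>A longest chain in \<open>X\<close> gets \<open>X\<close> as its top member, and
    \<open>L\<close> is put above it.\<close>
  define Y' where "Y' i = (if i < var_dim X then Y i else if i = var_dim X then X else L)" for i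
  have "variety_chain L Y' (Suc (var_dim X))"
    unfolding variety_chain_def
  proof (intro conjI allI impI)
    fix i assume "i \<le> Suc (var_dim X)"
    then show "irreducible_variety (Y' i)" "Y' i \<subseteq> L"
      using Y X L XL by (simp_all add: Y'_def variety_chain_def) (metis less_imp_le order.trans psubset_imp_subset)
  next
    fix i assume "i < Suc (var_dim X)"
    then consider "Suc i < var_dim X" | "Suc i = var_dim X" | "i = var_dim X" by linarith
    then show "Y' i \<subset> Y' (Suc i)"
    proof cases
      case 1
      then show ?thesis using Y by (simp add: Y'_def variety_chain_def)
    next
      case 2
      then have "Y i \<subset> Y (Suc i)" "Y (Suc i) \<subseteq> X"
        using Y by (simp_all add: variety_chain_def flip: 2)
      then show ?thesis using 2 by (auto simp: Y'_def)
    next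
      case 3
      then show ?thesis using XL by (simp add: Y'_def)
    qed
  qed
  then have "Suc (var_dim X) \<le> var_dim L"
    unfolding var_dim_eq[of L] using variety_chain_bdd[OF L] by (intro cSup_upper) auto
  then show ?thesis by simp
qed

section \<open>Linear spaces and the singular vertex of a cone\<close>

text \<open>Reduces vanishing to univariate polynomials, both on lines in a linear space and on
  lines of pairs \<open>(u + t *s x, t *s x)\<close>.\<close>

lemma polyfun_line:
  assumes "polyfun coord f" and "\<And>i. \<exists>p. \<forall>t. coord i (\<gamma> t) = poly p t"
  shows "\<exists>p. \<forall>t. f (\<gamma> t) = poly p t"
  using assms(1)
proof induction
  case (pf_const c)
  show ?case by (intro exI[of _ "[:c:]"]) simp
next
  case (pf_coord i)
  show ?case by (rule assms(2))
next
  case (pf_add f g)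
  then obtain p q where "\<forall>t. f (\<gamma> t) = poly p t" "\<forall>t. g (\<gamma> t) = poly q t" by blast
  then show ?case by (intro exI[of _ "p + q"]) simp
next
  case (pf_mult f g)
  then obtain p q where "\<forall>t. f (\<gamma> t) = poly p t" "\<forall>t. g (\<gamma> t) = poly q t" by blast
  then show ?case by (intro exI[of _ "p * q"]) simp
qed

lemma affine_coord_poly: "\<exists>p. \<forall>t. cn_coord i (a + t *s b) = poly p t"
  by (intro exI[of _ "[:a $ i, b $ i:]"]) (simp add: cn_coord_def)

lemma polyfun_bilin: "polyfun cn_coord (bilin g)"
  unfolding bilin_def
  using pf_mult[OF pf_const pf_coord[of cn_coord]]
  by (intro polyfun_sum) (auto simp: cn_coord_def)

text \<open>A point outside \<open>A\<close> and a point outside \<open>B\<close> are joined by a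
  line in \<open>L\<close>. Equations of \<open>A\<close> and \<open>B\<close> that are nonzero at
  these points restrict to nonzero univariate polynomials whose product is zero.\<close>

lemma irreducible_subspace:
  fixes L :: "(complex^'n) set"
  assumes L: "vec.subspace L" "zariski_closed L"
  shows "irreducible_variety L"
  unfolding irreducible_variety_def
proof (intro conjI allI impI L)
  show "L \<noteq> {}" using vec.subspace_0[OF L(1)] by blast
  fix A B :: "(complex^'n) set"
  assume AB: "zariski_closed A \<and> zariski_closed B \<and> L = A \<union> B"
  show "L = A \<or> L = B"
  proof (rule ccontr)
    assume "\<not> (L = A \<or> L = B)"
    then obtain a b where ab: "a \<in> L" "a \<notin> A" "b \<in> L" "b \<notin> B" using AB by blast
    obtain F G where F: "\<forall>f\<in>F. polyfun cn_coord f" "A = {x. \<forall>f\<in>F. f x = 0}"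
      and G: "\<forall>f\<in>G. polyfun cn_coord f" "B = {x. \<forall>f\<in>G. f x = 0}"
      using AB by (auto simp: zariski_closed_def)
    obtain f g where f: "polyfun cn_coord f" "\<forall>x\<in>A. f x = 0" "f a \<noteq> 0"
      and g: "polyfun cn_coord g" "\<forall>x\<in>B. g x = 0" "g b \<noteq> 0"
      using F G ab by blast
    let ?l = "\<lambda>t. a + t *s (b - a)"
    obtain p q where p: "\<forall>t. f (?l t) = poly p t" and q: "\<forall>t. g (?l t) = poly q t"
      using polyfun_line[OF f(1) affine_coord_poly] polyfun_line[OF g(1) affine_coord_poly] by meson
    have "?l t \<in> L" for t
      using ab L(1) by (intro vec.subspace_add vec.subspace_scale vec.subspace_diff)
    then have "f (?l t) * g (?l t) = 0" for t using AB f(2) g(2) by (metis Un_iff mult_eq_0_iff)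
    then have "poly (p * q) t = 0" for t using p q by simp
    then have "p * q = 0" using poly_all_0_iff_0 by blast
    moreover have "poly p 0 \<noteq> 0" using p[rule_format, of 0] f(3) by simp
    moreover have "poly q 1 \<noteq> 0" using q[rule_format, of 1] g(3) by simp
    ultimately show False by auto
  qed
qed

lemma tangent_space_subspace: "vec.subspace (tangent_space X x)"
  by (auto simp: vec.subspace_def tangent_space_def bilin_add_right bilin_scale_right)
    (simp add: bilin_def)

lemma tangent_space_closed: "zariski_closed (tangent_space X x)"
  unfolding zariski_closed_def tangent_space_def
  by (intro exI[of _ "bilin ` jac_rows X x"]) (auto simp: polyfun_bilin)

text \<open>Each row \<open>g\<close> gives the linear form \<open>bilin g\<close>, which vanishes
  on the tangent space and has constant gradient \<open>g\<close>.\<close>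

lemma jac_rows_subset_tangent_space:
  "jac_rows X x \<subseteq> jac_rows (tangent_space X x) y"
proof
  fix g assume g: "g \<in> jac_rows X x"
  have "bilin g \<in> var_ideal (tangent_space X x)"
    using g polyfun_bilin by (auto simp: var_ideal_def tangent_space_def)
  moreover have "grad_at (bilin g) y = g"
    by (rule grad_at_eqI)
      (auto simp: bilin_add_right bilin_scale_right intro!: derivative_eq_intros)
  ultimately show "g \<in> jac_rows (tangent_space X x) y" by (force simp: jac_rows_def)
qed

text \<open>An equation of \<open>X\<close> vanishes on the whole line through \<open>0\<close> and
  a point of the cone, so its derivative at \<open>0\<close> in that direction is zero.\<close>

lemma cone_subset_tangent_space_0:
  assumes "affine_cone X"
  shows "X \<subseteq> tangent_space X 0"
proof
  fix x assume x: "x \<in> X"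
  have "bilin (grad_at f 0) x = 0" if f: "f \<in> var_ideal X" for f
  proof -
    have "((\<lambda>t. f (0 + t *s x)) has_field_derivative bilin (grad_at f 0) x) (at 0)"
      using f by (intro has_derivative_grad) (simp add: var_ideal_iff)
    moreover have "(\<lambda>t. f (0 + t *s x)) = (\<lambda>t. 0)"
      using f x assms by (auto simp: var_ideal_def affine_cone_def)
    ultimately show ?thesis using DERIV_unique[OF _ DERIV_const] by metis
  qed
  then show "x \<in> tangent_space X 0" by (auto simp: tangent_space_def jac_rows_def)
qed

text \<open>With \<open>?L\<close> the tangent space at \<open>0\<close>, the Jacobian rank of
  \<open>X\<close> at \<open>0\<close> is at most that of \<open>?L\<close>, hence at most
  \<open>CARD('n) - var_dim ?L\<close>, which is less than \<open>codim X\<close>. The inclusion of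
  \<open>X\<close> in \<open>?L\<close> is strict because \<open>X\<close> is not linear.\<close>

lemma zero_in_Sing_cone:
  assumes X: "irreducible_variety X" and cone: "affine_cone X" and nl: "\<not> vec.subspace X"
  shows "0 \<in> Sing X"
proof -
  let ?L = "tangent_space X 0"
  obtain x where "x \<in> X" using X by (auto simp: irreducible_variety_def)
  then have "0 *s x \<in> X" using cone unfolding affine_cone_def by blast
  then have 0: "0 \<in> X" by simp
  have L: "irreducible_variety ?L"
    by (rule irreducible_subspace[OF tangent_space_subspace tangent_space_closed])
  have sub: "X \<subset> ?L"
    using cone_subset_tangent_space_0[OF cone] nl tangent_space_subspace[of X 0] by fastforce
  have "0 \<in> ?L" using 0 sub by blast
  have "vec.dim (jac_rows X 0) \<le> vec.dim (jac_rows ?L 0)"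
    by (rule vec.dim_subset[OF jac_rows_subset_tangent_space])
  then have "vec.dim (jac_rows X 0) < codim X"
    using var_dim_less[OF X L sub] var_dim_rank[OF L \<open>0 \<in> ?L\<close>] by (simp add: codim_def)
  then show ?thesis using 0 by (simp add: Sing_def)
qed

section \<open>Rows of the Jacobian: duality and scaling\<close>

text \<open>The rows come from the whole ideal, so they are closed under linear combinations and
  equal their span.\<close>

lemma subspace_jac_rows:
  fixes X :: "(complex^'n) set"
  shows "vec.subspace (jac_rows X x)"
proof (rule vec.subspaceI)
  show "0 \<in> jac_rows X x"
    by (auto simp: jac_rows_def var_ideal_iff vanishes_on_def grad_at_0 intro!: exI[of _ 0] polyfun_zero)
  fix g h assume "g \<in> jac_rows X x" "h \<in> jac_rows X x"
  then obtain p q where pq: "p \<in> var_ideal X" "q \<in> var_ideal X" "g = grad_at p x" "h = grad_at q x"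
    by (auto simp: jac_rows_def)
  then have "p + q \<in> var_ideal X" "g + h = grad_at (p + q) x"
    by (auto simp: var_ideal_iff vanishes_on_def grad_at_add intro: polyfun_plus)
  then show "g + h \<in> jac_rows X x" unfolding jac_rows_def by blast
next
  fix c g assume "g \<in> jac_rows X x"
  then obtain f where f: "f \<in> var_ideal X" "g = grad_at f x" by (auto simp: jac_rows_def)
  have k: "polyfun cn_coord (\<lambda>_ :: complex^'n. c)" by (rule pf_const)
  have "grad_at (\<lambda>_. c) x = 0" by (rule grad_at_eqI) (simp add: bilin_zero_left)
  then have "c *s g = grad_at ((\<lambda>_. c) * f) x"
    using f k by (simp add: var_ideal_iff grad_at_mult)
  moreover have "(\<lambda>_. c) * f \<in> var_ideal X"
    using f k by (auto simp: var_ideal_iff vanishes_on_def intro: polyfun_times)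
  ultimately show "c *s g \<in> jac_rows X x" unfolding jac_rows_def by blast
qed

text \<open>The double orthogonal complement of \<open>W\<close> lies in \<open>W\<close>. The form
  may have isotropic vectors, so instead of an orthogonal projection the proof takes a linear
  functional that is zero on \<open>W\<close> and nonzero at \<open>u\<close>, and represents it as
  \<open>bilin\<close> with some \<open>v\<close>.\<close>

lemma mem_subspace_if_orthogonal:
  fixes W :: "(complex^'n) set"
  assumes W: "vec.subspace W" and u: "\<And>v. (\<forall>w\<in>W. bilin w v = 0) \<Longrightarrow> bilin u v = 0"
  shows "u \<in> W"
proof (rule ccontr)
  assume "u \<notin> W"
  obtain B where B: "B \<subseteq> W" "vec.independent B" "W \<subseteq> vec.span B"
    by (rule vec.basis_exists)
  then have "vec.span B = W" using vec.span_eq_iff[THEN iffD2, OF W] vec.span_mono by blast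
  then have ind: "vec.independent (insert u B)"
    using B(2) \<open>u \<notin> W\<close> by (simp add: vec.independent_insert)
  \<comment> \<open>An arbitrary coordinate: the functional is the \<open>k\<close>-th component of
    a linear map from the space to itself.\<close>
  define k :: 'n where "k = undefined"
  obtain \<phi> :: "complex^'n \<Rightarrow> complex^'n" where lin: "Vector_Spaces.linear (*s) (*s) \<phi>"
    and \<phi>: "\<forall>x\<in>insert u B. \<phi> x = (if x = u then axis k 1 else 0)"
    using vec.linear_independent_extend[OF ind, of "\<lambda>x. if x = u then axis k 1 else 0"] by auto
  interpret \<phi>: Vector_Spaces.linear "(*s)" "(*s)" \<phi> by (rule lin)
  define v where "v = (\<chi> i. \<phi> (axis i 1) $ k)"
  have bv: "bilin w v = \<phi> w $ k" for w
  proof -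
    have "\<phi> w = \<phi> (\<Sum>i\<in>UNIV. w $ i *s axis i 1)" by (simp add: basis_expansion)
    also have "\<dots> = (\<Sum>i\<in>UNIV. w $ i *s \<phi> (axis i 1))" by (simp add: \<phi>.sum \<phi>.scale)
    finally show ?thesis by (simp add: bilin_def v_def)
  qed
  have "\<phi> w = 0" if "w \<in> vec.span B" for w
    by (rule \<phi>.eq_0_on_span[OF _ that]) (use \<phi> \<open>u \<notin> W\<close> B(1) in auto)
  then have "bilin w v = 0" if "w \<in> W" for w using bv B(3) that by (metis subsetD zero_index)
  with u have "bilin u v = 0" by blast
  then show False using \<phi> by (simp add: bv axis_def)
qed

text \<open>If \<open>f\<close> is in the ideal of a cone, so is \<open>f (inverse t *s y)\<close>
  as a function of \<open>y\<close>; its gradient at \<open>t *s x\<close> is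
  \<open>inverse t\<close> times that of \<open>f\<close> at \<open>x\<close>.\<close>

lemma jac_rows_scale:
  assumes cone: "affine_cone X" and t: "t \<noteq> 0"
  shows "jac_rows X x \<subseteq> jac_rows X (t *s x)"
proof
  fix g assume "g \<in> jac_rows X x"
  then obtain f where f: "f \<in> var_ideal X" "g = grad_at f x" by (auto simp: jac_rows_def)
  let ?h = "\<lambda>y. f (inverse t *s y)"
  have "polyfun cn_coord (\<lambda>y. cn_coord i (inverse t *s y))" for i :: 'a
    using pf_mult[OF pf_const pf_coord[of cn_coord i], of "inverse t"] by (simp add: cn_coord_def)
  then have h: "?h \<in> var_ideal X"
    using f(1) cone polyfun_compose[of cn_coord f cn_coord "\<lambda>y. inverse t *s y"]
    by (auto simp: var_ideal_def affine_cone_def)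
  have "grad_at ?h (t *s x) = inverse t *s g"
  proof (rule grad_at_eqI)
    fix v
    have "((\<lambda>s. f (x + s *s (inverse t *s v))) has_field_derivative bilin g (inverse t *s v)) (at 0)"
      unfolding f(2) using f(1) by (intro has_derivative_grad) (simp add: var_ideal_iff)
    moreover have "inverse t *s (t *s x + s *s v) = x + s *s (inverse t *s v)" for s
      using t by (simp add: vec_eq_iff algebra_simps)
    ultimately show "((\<lambda>s. f (inverse t *s (t *s x + s *s v))) has_field_derivative
        bilin (inverse t *s g) v) (at 0)"
      by (simp add: bilin_scale_left bilin_scale_right)
  qed
  then have "inverse t *s g \<in> jac_rows X (t *s x)" using h by (force simp: jac_rows_def)
  then have "t *s (inverse t *s g) \<in> jac_rows X (t *s x)"
    using subspace_jac_rows vec.subspace_scale by blast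
  then show "g \<in> jac_rows X (t *s x)" using t by simp
qed

lemma jac_rows_scale_eq:
  assumes cone: "affine_cone X" and t: "t \<noteq> 0"
  shows "jac_rows X (t *s x) = jac_rows X x"
  using jac_rows_scale[OF assms, of x] jac_rows_scale[OF cone, of "inverse t" "t *s x"] t
  by auto

lemma Xreg_scale:
  assumes cone: "affine_cone X" and "t \<noteq> 0" "x \<in> Xreg X"
  shows "t *s x \<in> Xreg X"
  using assms jac_rows_scale_eq[OF assms(1,2), of x]
  by (auto simp: Xreg_def Sing_def affine_cone_def)

section \<open>The ED correspondence, conormal vectors and the two inclusions\<close>

abbreviation ED_pairs :: "(complex^'n) set \<Rightarrow> ((complex^'n) \<times> (complex^'n)) set" where
  "ED_pairs X \<equiv>
     {(u, x). x \<in> Xreg X \<and> vec.dim (insert (u - x) (jac_rows X x)) \<le> codim X}"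

abbreviation conormal_vectors :: "(complex^'n) set \<Rightarrow> (complex^'n) set" where
  "conormal_vectors X \<equiv> {u. \<exists>x\<in>Xreg X. \<forall>v\<in>tangent_space X x. bilin u v = 0}"

text \<open>At a regular point the rows have rank at least \<open>codim X\<close>, so adjoining
  \<open>u - x\<close> without exceeding \<open>codim X\<close> forces it into their span.\<close>

lemma ED_pair_diff_conormal:
  assumes "(u, x) \<in> ED_pairs X"
  shows "u - x \<in> conormal_vectors X"
proof -
  from assms have x: "x \<in> Xreg X" and d: "vec.dim (insert (u - x) (jac_rows X x)) \<le> codim X" by auto
  have "codim X \<le> vec.dim (jac_rows X x)" using x by (auto simp: Xreg_def Sing_def)
  then have "u - x \<in> vec.span (jac_rows X x)"
    using d by (auto simp: vec.dim_insert split: if_splits)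
  then have "u - x \<in> jac_rows X x" using subspace_jac_rows vec.span_eq_iff by blast
  then show ?thesis using x by (auto simp: tangent_space_def)
qed

text \<open>A vector orthogonal to the tangent space is itself a row, so adjoining it leaves the
  rank unchanged; \<open>var_dim_rank\<close> bounds that rank by \<open>codim X\<close>.\<close>

lemma conormal_ED_pair:
  assumes X: "irreducible_variety X" and x: "x \<in> Xreg X"
    and u: "\<forall>v\<in>tangent_space X x. bilin u v = 0"
  shows "(u + x, x) \<in> ED_pairs X"
proof -
  have "u \<in> jac_rows X x"
    using u by (intro mem_subspace_if_orthogonal[OF subspace_jac_rows]) (auto simp: tangent_space_def)
  then have "insert (u + x - x) (jac_rows X x) = jac_rows X x" by (simp add: insert_absorb)
  moreover have "vec.dim (jac_rows X x) \<le> codim X"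
    using var_dim_rank[OF X, of x] x by (auto simp: codim_def Xreg_def)
  ultimately have "vec.dim (insert (u + x - x) (jac_rows X x)) \<le> codim X" by (simp only:)
  then show ?thesis using x by blast
qed

text \<open>Equations of the dual variety, pulled back along \<open>(u, x) \<mapsto> u - x\<close>,
  vanish on \<open>ED_pairs X\<close> and hence on its closure.\<close>

lemma ED_corr_diff_dual:
  fixes X :: "(complex^'n) set"
  assumes "(u, x) \<in> ED_corr X"
  shows "u - x \<in> dual_variety X"
  unfolding dual_variety_def zariski_closure_def
proof (intro CollectI allI impI)
  fix f :: "complex^'n \<Rightarrow> complex"
  assume f: "polyfun cn_coord f \<and> (\<forall>q\<in>conormal_vectors X. f q = 0)"
  have "polyfun pair_coord (\<lambda>p :: (complex^'n) \<times> (complex^'n). cn_coord i (fst p - snd p))" for i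
  proof -
    have "(\<lambda>p :: (complex^'n) \<times> (complex^'n). cn_coord i (fst p - snd p)) =
        (\<lambda>p. pair_coord (Inl i) p - pair_coord (Inr i) p)"
      by (simp add: pair_coord_def cn_coord_def)
    then show ?thesis by (simp only:) (intro polyfun_diff pf_coord)
  qed
  then have "polyfun pair_coord (\<lambda>p. f (fst p - snd p))"
    using f polyfun_compose[of cn_coord f pair_coord "\<lambda>p. fst p - snd p"] by blast
  moreover have "\<forall>q\<in>ED_pairs X. f (fst q - snd q) = 0"
    using f ED_pair_diff_conormal by fastforce
  ultimately have "f (fst (u, x) - snd (u, x)) = 0"
    using assms unfolding ED_corr_def zariski_closure_def by blast
  then show "f (u - x) = 0" by simp
qed

text \<open>For \<open>t \<noteq> 0\<close> the pair \<open>(u + t *s x, t *s x)\<close> stays in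
  \<open>ED_pairs X\<close>. A polynomial vanishing on all these pairs restricts to a univariate one
  with infinitely many roots, so it also vanishes at \<open>t = 0\<close>.\<close>

lemma conormal_ED_corr_0:
  assumes X: "irreducible_variety X" and cone: "affine_cone X" and u: "u \<in> conormal_vectors X"
  shows "(u, 0) \<in> ED_corr X"
  unfolding ED_corr_def zariski_closure_def
proof (intro CollectI allI impI)
  fix f assume f: "polyfun pair_coord f \<and> (\<forall>q\<in>ED_pairs X. f q = 0)"
  obtain x where x: "x \<in> Xreg X" "\<forall>v\<in>tangent_space X x. bilin u v = 0" using u by blast
  let ?l = "\<lambda>t. (u + t *s x, t *s x)"
  have "\<exists>p. \<forall>t. pair_coord i (?l t) = poly p t" for i
    by (cases i)
      (auto simp: pair_coord_def intro: exI[of _ "[:u $ _, x $ _:]"] exI[of _ "[:0, x $ _:]"])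
  then obtain p where p: "\<forall>t. f (?l t) = poly p t" using polyfun_line[of pair_coord f ?l] f by blast
  have "poly p t = 0" if "t \<noteq> 0" for t
  proof -
    have "tangent_space X (t *s x) = tangent_space X x"
      using jac_rows_scale_eq[OF cone that] by (simp add: tangent_space_def)
    then have "?l t \<in> ED_pairs X"
      using conormal_ED_pair[OF X Xreg_scale[OF cone that x(1)], of u] x(2) by blast
    then have "f (?l t) = 0" using f by blast
    then show ?thesis using p by simp
  qed
  then have "- {0} \<subseteq> {t. poly p t = 0}" by blast
  moreover have "infinite (- {0 :: complex})" by (simp add: Compl_eq_Diff_UNIV infinite_UNIV_char_0)
  ultimately have "p = 0" using poly_roots_finite finite_subset by metis
  then show "f (u, 0) = 0" using p[rule_format, of 0] by simp
qed

text \<open>The map \<open>w \<mapsto> (w, 0)\<close> is polynomial, so the result for conormal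
  vectors passes to their closure.\<close>

lemma dual_ED_corr_0:
  fixes X :: "(complex^'n) set"
  assumes X: "irreducible_variety X" and cone: "affine_cone X" and u: "u \<in> dual_variety X"
  shows "(u, 0) \<in> ED_corr X"
  unfolding ED_corr_def zariski_closure_def
proof (intro CollectI allI impI)
  fix f :: "(complex^'n) \<times> (complex^'n) \<Rightarrow> complex"
  assume f: "polyfun pair_coord f \<and> (\<forall>q\<in>ED_pairs X. f q = 0)"
  have "polyfun cn_coord (\<lambda>w. pair_coord i (w, 0 :: complex^'n))" for i
    using pf_coord[of "cn_coord :: 'n \<Rightarrow> _"] pf_const[of "cn_coord :: 'n \<Rightarrow> _" 0]
    by (cases i) (auto simp: pair_coord_def cn_coord_def[abs_def])
  then have "polyfun cn_coord (\<lambda>w. f (w, 0))"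
    using f polyfun_compose[of pair_coord f cn_coord "\<lambda>w. (w, 0)"] by blast
  moreover have "\<forall>w\<in>conormal_vectors X. f (w, 0) = 0"
    using conormal_ED_corr_0[OF X cone] f unfolding ED_corr_def zariski_closure_def by blast
  ultimately show "f (u, 0) = 0"
    using u unfolding dual_variety_def zariski_closure_def by blast
qed

theorem theorem2p1:
  fixes X :: "(complex^'n) set"
  assumes "irreducible_variety X"
    and "affine_cone X"
    and "\<not> vec.subspace X"
  shows "dual_variety X \<subseteq> ED_data_singular X \<and>
         ED_data_singular X \<subseteq> {a + b | a b. a \<in> dual_variety X \<and> b \<in> Sing X}"
proof (intro conjI subsetI)
  fix u assume "u \<in> dual_variety X"
  then have "(u, 0) \<in> ED_corr X" using dual_ED_corr_0 assms by blast
  then show "u \<in> ED_data_singular X"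
    using zero_in_Sing_cone[OF assms] unfolding ED_data_singular_def by force
next
  fix u assume "u \<in> ED_data_singular X"
  then obtain x where "(u, x) \<in> ED_corr X" "x \<in> Sing X"
    by (auto simp: ED_data_singular_def)
  moreover have "u = (u - x) + x" by simp
  ultimately show "u \<in> {a + b | a b. a \<in> dual_variety X \<and> b \<in> Sing X}"
    using ED_corr_diff_dual by blast
qed

end
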